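(* Let $G$ be a locally compact Abelian group. Suppose $\Omega_+ \subset G$ is an open $0$-symmetric neighborhood of $0$ satisfying the strict packing type condition $\Omega_+ \cap (\Lambda - \Lambda) = \{0\}$ with a translation set $\Lambda \subset G$. Let $\Omega_-\subset G$ be any open, $0$-symmetric set. Then $$\mathcal{C}(\Omega_+, \Omega_-) \le \frac{1}{\overline{D}^{\#}(\Lambda)}.$$
   Context: $G$ is written additively and $m_G$ is a fixed Haar measure on $G$; all integrals over $G$ are with respect to $m_G$. A set $A\subset G$ is $0$-symmetric if $A=-A$. $\mathcal{B}_0$ is the class of Borel subsets of $G$ with compact closure. $A_1\Subset A_2$ means that $A_1$ is a compact subset of $A_2$. $\Lambda-\Lambda=\{\lambda-\lambda':\lambda,\lambda'\in\Lambda\}$. For $f:G\to\mathbb{R}$, $f_+=\max\{f,0\}$, $f_-=\max\{-f,0\}$, and $\operatorname{supp} f=\overline{\{x: f(x)\neq 0\}}$. $f\gg 0$ means that $f$ is positive definite: $\sum_{n,m=1}^N c_n\overline{c_m} f(x_n-x_m)\ge 0$ for all $N\in\mathbb{N}$, $x_1,\dots,x_N\in G$, $c_1,\dots,c_N\in\mathbb{C}$. For open sets $\Omega_+,\Omega_-\subset G$ let $\mathcal{F}_c(\Omega_+,\Omega_-)$ be the set of continuous real-valued $f$ on $G$ with $f\gg 0$, $f(0)=1$, $\operatorname{supp} f_+\Subset\Omega_+$, $\operatorname{supp} f_-\Subset\Omega_-$, and $$\mathcal{C}(\Omega_+,\Omega_-) := \sup\Big\{\int_G f : f\in\mathcal{F}_c(\Omega_+,\Omega_-)\Big\}$$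 (supremum over the empty class is $0$). (The same value is obtained if one takes the supremum over all continuous $f\in L^1(G)$ with $f\gg0$, $f(0)=1$, $\operatorname{supp} f_\pm\subset\Omega_\pm$.) The asymptotic uniform upper density of a discrete set $\Lambda\subset G$ is $$\overline{D}^{\#}(\Lambda) := \inf_{C\Subset G}\ \sup_{V\in\mathcal{B}_0}\frac{\#(\Lambda\cap V)}{m_G(C+V)}.$$ Conventions: $a/0=+\infty$ for $a>0$, $0/0=0$ in the quotient in this definition, and $1/\overline{D}^{\#}(\Lambda)=+\infty$ if $\overline{D}^{\#}(\Lambda)=0$. *)

theory Defs
  imports "HOL-Analysis.Analysis"
begin

(* Regularity is the usual one for Haar measures on groups that need not be sigma-compact:
   outer regularity on Borel sets, inner regularity on open sets. Invariance together with
   the last conjunct makes every nonempty open set have positive measure. *)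
definition haar_measure :: "'a::{topological_ab_group_add, t2_space} measure \<Rightarrow> bool" where
  "haar_measure M \<longleftrightarrow>
     sets M = sets borel \<and>
     (\<forall>x. \<forall>A\<in>sets borel. emeasure M ((\<lambda>a. x + a) ` A) = emeasure M A) \<and>
     (\<forall>K. compact K \<longrightarrow> emeasure M K < \<infinity>) \<and>
     (\<forall>A\<in>sets borel. emeasure M A = (INF U\<in>{U. open U \<and> A \<subseteq> U}. emeasure M U)) \<and>
     (\<forall>U. open U \<longrightarrow> emeasure M U = (SUP K\<in>{K. compact K \<and> K \<subseteq> U}. emeasure M K)) \<and>
     emeasure M UNIV \<noteq> 0"

(* The image is needed because "- A" denotes the complement of A in HOL. *)
definition zero_symmetric :: "'a::ab_group_add set \<Rightarrow> bool" where
  "zero_symmetric A \<longleftrightarrow> A = uminus ` A"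

(* Likewise, binary "-" on sets is the set difference in HOL. *)
definition difference_set :: "'a::ab_group_add set \<Rightarrow> 'a set" where
  "difference_set A = {x - y | x y. x \<in> A \<and> y \<in> A}"

definition sum_set :: "'a::ab_group_add set \<Rightarrow> 'a set \<Rightarrow> 'a set" where
  "sum_set A B = {x + y | x y. x \<in> A \<and> y \<in> B}"

definition compact_subset :: "'a::topological_space set \<Rightarrow> 'a set \<Rightarrow> bool" (infix "\<Subset>" 50) where
  "A \<Subset> B \<longleftrightarrow> compact A \<and> A \<subseteq> B"

definition bounded_borel :: "'a::topological_space set set" where
  "bounded_borel = {V. V \<in> sets borel \<and> compact (closure V)}"

definition pos_part :: "('a \<Rightarrow> real) \<Rightarrow> 'a \<Rightarrow> real" where
  "pos_part f = (\<lambda>x. max (f x) 0)"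

definition neg_part :: "('a \<Rightarrow> real) \<Rightarrow> 'a \<Rightarrow> real" where
  "neg_part f = (\<lambda>x. max (- f x) 0)"

definition supp :: "('a::topological_space \<Rightarrow> real) \<Rightarrow> 'a set" where
  "supp f = closure {x. f x \<noteq> 0}"

definition positive_definite :: "('a::ab_group_add \<Rightarrow> real) \<Rightarrow> bool" where
  "positive_definite f \<longleftrightarrow>
     (\<forall>(N::nat) (x :: nat \<Rightarrow> 'a) (c :: nat \<Rightarrow> complex).
        (\<Sum>n=1..N. \<Sum>m=1..N. c n * cnj (c m) * complex_of_real (f (x n - x m))) \<in> \<real>\<^sub>\<ge>\<^sub>0)"

definition admissible ::
  "'a::{topological_ab_group_add, t2_space} set \<Rightarrow> 'a set \<Rightarrow> ('a \<Rightarrow> real) set" where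
  "admissible \<Omega>p \<Omega>m =
     {f. continuous_on UNIV f \<and> positive_definite f \<and> f 0 = 1 \<and>
         supp (pos_part f) \<Subset> \<Omega>p \<and> supp (neg_part f) \<Subset> \<Omega>m}"

(* The members of the class are continuous with compact support, hence Bochner integrable. *)
definition extremal_const ::
  "'a::{topological_ab_group_add, t2_space} measure \<Rightarrow> 'a set \<Rightarrow> 'a set \<Rightarrow> ereal" where
  "extremal_const M \<Omega>p \<Omega>m =
     (if admissible \<Omega>p \<Omega>m = {} then 0
      else (SUP f\<in>admissible \<Omega>p \<Omega>m. ereal (\<integral>x. f x \<partial>M)))"

(* Division in ennreal satisfies a / 0 = \<infinity> for a > 0 and 0 / 0 = 0.
   The numerator is the number of points of the intersection, in the extended sense.
   The sum of a compact set and a Borel set need not be Borel, and emeasure is 0 outside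
   the sigma-algebra. Therefore the denominator uses the outer measure, which agrees with
   M, and with its completion, wherever these are defined. *)
definition upper_density ::
  "'a::{topological_ab_group_add, t2_space} measure \<Rightarrow> 'a set \<Rightarrow> ennreal" where
  "upper_density M \<Lambda> =
     (INF C\<in>{C. C \<Subset> UNIV}. SUP V\<in>bounded_borel.
        emeasure (count_space UNIV) (\<Lambda> \<inter> V) / outer_measure_of M (sum_set C V))"

end

theory Submission
  imports Defs
begin

text \<open>
  Let \<open>f\<close> be admissible, \<open>I = \<integral>f > 0\<close>, \<open>J = \<integral>\<bar>f\<bar>\<close> and \<open>S = supp f\<close>, which is compact. If \<open>x, y \<in> \<Lambda>\<close> are
  distinct, then \<open>x - y \<notin> \<Omega>p\<close> and therefore \<open>f (x - y) \<le> 0\<close>.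

  The analytic core is \<open>card_separated_le\<close>: for a finite \<open>F \<subseteq> \<Lambda>\<close> and compact sets
  \<open>F \<subseteq> W' \<subseteq> W\<close> with \<open>W' + S \<subseteq> W\<close>,
  \<open>card F * I\<^sup>2 \<le> I * M(W) + J * (M(W) - M(W'))\<close>.
  It follows from \<open>\<integral>\<integral> f (x - y) d\<mu>(x) d\<mu>(y) \<ge> 0\<close> for the signed measure \<open>\<mu>\<close> that puts mass \<open>1\<close> at each
  point of \<open>F\<close> and has density \<open>- 1 / I\<close> on \<open>W\<close>. The double integral is replaced by Riemann sums over
  fine Borel partitions of \<open>W\<close>, so that positive definiteness enters only through finite sums.

  Suppose that \<open>a < upper_density M \<Lambda>\<close> for some \<open>a > 1 / I\<close>. Then for every \<open>n\<close> some finite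
  \<open>F \<subseteq> \<Lambda>\<close> has \<open>card F > a * M(n S + F)\<close>. Applied to \<open>W' = k S + F\<close> and \<open>W = (k + 1) S + F\<close> for \<open>k < n\<close>, the
  core estimate shows that \<open>M((k + 1) S + F) \<ge> (1 + c) * M(k S + F)\<close> with \<open>c > 0\<close> independent of \<open>n\<close>
  and \<open>F\<close>. For \<open>k = 0\<close> it also gives \<open>card F * I\<^sup>2 \<le> (I + J) * M(S + F)\<close>. Hence
  \<open>card F > a * (1 + c)^(n - 1) * M(S + F) \<ge> a * (1 + c)^(n - 1) * card F * I\<^sup>2 / (I + J)\<close>, which is
  false for large \<open>n\<close>. This comparison takes the place of a Folner sequence in \<open>G\<close>: the density
  itself bounds the growth of the sets \<open>k S + F\<close>.
\<close>

section \<open>Sums of sets\<close>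

lemma compact_sum_set:
  fixes A B :: "'a::topological_ab_group_add set"
  assumes "compact A" "compact B"
  shows "compact (sum_set A B)"
proof -
  have "sum_set A B = (\<lambda>(x, y). x + y) ` (A \<times> B)"
    by (auto simp: sum_set_def)
  moreover have "compact ((\<lambda>(x, y). x + y) ` (A \<times> B))"
    unfolding case_prod_beta
    by (intro compact_continuous_image compact_Times assms continuous_intros)
  ultimately show ?thesis
    by simp
qed

text \<open>The \<open>k\<close>-fold sum \<open>S + \<dots> + S\<close>; the empty sum is \<open>{0}\<close>.\<close>

definition iterated_sum :: "'a::ab_group_add set \<Rightarrow> nat \<Rightarrow> 'a set" where
  "iterated_sum S k = (sum_set S ^^ k) {0}"

lemma compact_iterated_sum:
  fixes S :: "'a::topological_ab_group_add set"
  assumes "compact S"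
  shows "compact (iterated_sum S k)"
  using assms by (induction k) (auto simp: iterated_sum_def compact_sum_set)

lemma sum_set_iterated_sum_0: "sum_set (iterated_sum S 0) A = A"
  by (simp add: sum_set_def iterated_sum_def)

lemma sum_set_assoc: "sum_set (sum_set A B) D = sum_set A (sum_set B D)"
proof (intro subset_antisym subsetI)
  fix x assume "x \<in> sum_set (sum_set A B) D"
  then obtain a b d where "a \<in> A" "b \<in> B" "d \<in> D" "x = a + (b + d)"
    by (auto simp: sum_set_def add.assoc)
  then show "x \<in> sum_set A (sum_set B D)"
    unfolding sum_set_def by blast
next
  fix x assume "x \<in> sum_set A (sum_set B D)"
  then obtain a b d where "a \<in> A" "b \<in> B" "d \<in> D" "x = (a + b) + d"
    by (auto simp: sum_set_def add.assoc)
  then show "x \<in> sum_set (sum_set A B) D"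
    unfolding sum_set_def by blast
qed

lemma sum_set_iterated_sum_Suc:
  "sum_set (iterated_sum S (Suc k)) A = sum_set S (sum_set (iterated_sum S k) A)"
  by (simp add: iterated_sum_def sum_set_assoc)

section \<open>Fine Borel partitions of compact sets\<close>

lemma compact_uniform_neighbourhood:
  fixes f :: "'a::topological_ab_group_add \<Rightarrow> real"
  assumes "continuous_on UNIV f" "compact W" "\<delta> > 0"
  obtains U where "open U" "y \<in> U"
    "\<And>x z. x \<in> W \<Longrightarrow> z \<in> U \<Longrightarrow> \<bar>f (x - z) - f (x - y)\<bar> \<le> \<delta>"
proof -
  define O' where "O' = {p. \<bar>f (fst p - snd p) - f (fst p - y)\<bar> < \<delta>}"
  have "continuous_on UNIV (\<lambda>p. f (fst p - snd p))" "continuous_on UNIV (\<lambda>p. f (fst p - y))"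
    by (auto intro!: continuous_on_compose2[OF assms(1)] continuous_intros)
  then have "open O'"
    unfolding O'_def by (intro open_Collect_less continuous_intros)
  moreover have "W \<times> {y} \<subseteq> O'"
    using \<open>\<delta> > 0\<close> by (auto simp: O'_def)
  ultimately obtain V U where "open U" "y \<in> U" "W \<subseteq> V" "V \<times> U \<subseteq> O'"
    using tube_lemma_left[of euclidean euclidean O' W y] \<open>compact W\<close>
    by (auto simp: open_openin[symmetric] compactin_euclidean_iff)
  then show ?thesis
    by (intro that[of U]) (fastforce simp: O'_def subset_eq)+
qed

lemma disjoint_refinement:
  assumes "finite Y" "\<And>y. y \<in> Y \<Longrightarrow> U y \<in> sets M"
  shows "\<exists>P. disjoint_family_on P Y \<and> (\<forall>y\<in>Y. P y \<in> sets M \<and> P y \<subseteq> U y) \<and> \<Union>(P ` Y) = \<Union>(U ` Y)"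
  using assms
proof (induction Y)
  case empty
  then show ?case by (auto simp: disjoint_family_on_def)
next
  case (insert y Y)
  then obtain P where P: "disjoint_family_on P Y" "\<forall>y\<in>Y. P y \<in> sets M \<and> P y \<subseteq> U y"
    "\<Union>(P ` Y) = \<Union>(U ` Y)"
    by auto
  let ?P = "P(y := U y - \<Union>(U ` Y))"
  have "\<Union>(?P ` insert y Y) = \<Union>(U ` insert y Y)"
    using insert.hyps P(3) by (auto split: if_splits)
  moreover have "disjoint_family_on ?P (insert y Y)"
    using insert.hyps P by (fastforce simp: disjoint_family_on_def)
  moreover have "\<forall>x\<in>insert y Y. ?P x \<in> sets M \<and> ?P x \<subseteq> U x"
    using insert P(2) by auto
  ultimately show ?case
    by blast
qed

text \<open>A finite Borel partition on which Riemann sums of \<open>\<lambda>z. f (x - z)\<close> are accurate up to \<open>\<delta>\<close>,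
  uniformly in \<open>x \<in> W\<close>. Integrating against such sums avoids product measures: without second
  countability \<open>(x, z) \<mapsto> f (x - z)\<close> need not be measurable for the product of the Borel
  \<open>\<sigma>\<close>-algebras, and \<open>M\<close> need not be \<open>\<sigma>\<close>-finite.\<close>

lemma fine_borel_partition:
  fixes f :: "'a::{topological_ab_group_add, t2_space} \<Rightarrow> real"
  assumes "continuous_on UNIV f" "compact W" "\<delta> > 0"
  obtains Y P where "finite Y" "Y \<subseteq> W" "disjoint_family_on P Y"
    "\<And>y. y \<in> Y \<Longrightarrow> P y \<in> sets borel" "\<Union>(P ` Y) = W"
    "\<And>x y z. x \<in> W \<Longrightarrow> y \<in> Y \<Longrightarrow> z \<in> P y \<Longrightarrow> \<bar>f (x - z) - f (x - y)\<bar> \<le> \<delta>"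
proof -
  have "\<exists>U. open U \<and> y \<in> U \<and> (\<forall>x\<in>W. \<forall>z\<in>U. \<bar>f (x - z) - f (x - y)\<bar> \<le> \<delta>)" for y
    by (rule compact_uniform_neighbourhood[OF assms]) blast
  then obtain U where U: "\<And>y. open (U y)" "\<And>y. y \<in> U y"
    "\<And>x y z. x \<in> W \<Longrightarrow> z \<in> U y \<Longrightarrow> \<bar>f (x - z) - f (x - y)\<bar> \<le> \<delta>"
    by metis
  obtain Y where Y: "finite Y" "Y \<subseteq> W" "W \<subseteq> \<Union>(U ` Y)"
  proof (rule compactE_image[OF \<open>compact W\<close>, of W U])
    show "W \<subseteq> \<Union>(U ` W)"
      using U(2) by blast
  qed (use U(1) in auto)
  have "\<exists>P. disjoint_family_on P Y \<and> (\<forall>y\<in>Y. P y \<in> sets borel \<and> P y \<subseteq> W \<inter> U y)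
      \<and> \<Union>(P ` Y) = (\<Union>y\<in>Y. W \<inter> U y)"
  proof (rule disjoint_refinement[OF \<open>finite Y\<close>])
    show "W \<inter> U y \<in> sets borel" for y
      using U(1) \<open>compact W\<close> by (intro sets.Int borel_compact borel_open)
  qed
  then obtain P where P: "disjoint_family_on P Y \<and> (\<forall>y\<in>Y. P y \<in> sets borel \<and> P y \<subseteq> W \<inter> U y)
      \<and> \<Union>(P ` Y) = (\<Union>y\<in>Y. W \<inter> U y)" ..
  show ?thesis
  proof (rule that[of Y P])
    have "(\<Union>y\<in>Y. W \<inter> U y) = W"
      using Y(3) by auto
    then show "\<Union>(P ` Y) = W"
      using P by simp
    show "\<bar>f (x - z) - f (x - y)\<bar> \<le> \<delta>" if "x \<in> W" "y \<in> Y" "z \<in> P y" for x y z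
    proof (rule U(3)[OF \<open>x \<in> W\<close>])
      show "z \<in> U y"
        using P that(2,3) by auto
    qed
  qed (use P Y in auto)
qed

section \<open>Positive definite functions\<close>

text \<open>The points \<open>p i\<close> are indexed and may coincide, so that two families of weights can be placed on
  overlapping sets of points.\<close>

lemma positive_definite_weighted_sum:
  fixes c :: "'i \<Rightarrow> real"
  assumes "positive_definite f" "finite A"
  shows "0 \<le> (\<Sum>i\<in>A. \<Sum>j\<in>A. c i * c j * f (p i - p j))"
proof -
  obtain h where h: "bij_betw h {1..card A} A"
    using ex_bij_betw_nat_finite_1[OF \<open>finite A\<close>] by blast
  have "complex_of_real (\<Sum>i\<in>A. \<Sum>j\<in>A. c i * c j * f (p i - p j))
     = (\<Sum>n=1..card A. \<Sum>m=1..card A. complex_of_real (c (h n)) * cnj (complex_of_real (c (h m)))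
         * complex_of_real (f (p (h n) - p (h m))))"
    by (simp add: sum.reindex_bij_betw[OF h, symmetric] del: One_nat_def)
  also have "\<dots> \<in> \<real>\<^sub>\<ge>\<^sub>0"
    using assms(1)[unfolded positive_definite_def, THEN spec, of "card A", THEN spec,
      of "\<lambda>n. p (h n)", THEN spec, of "\<lambda>n. complex_of_real (c (h n))"] .
  finally show ?thesis
    by (simp only: nonneg_Reals_of_real_iff)
qed

lemma positive_definite_even:
  assumes "positive_definite f"
  shows "f (- x) = f x"
proof -
  \<comment> \<open>With the points \<open>x, 0\<close> and the coefficients \<open>1, \<i>\<close> the imaginary part of the form is
    \<open>f (- x) - f x\<close>, which has to vanish.\<close>
  let ?x = "\<lambda>n::nat. if n = 1 then x else 0" and ?c = "\<lambda>n::nat. if n = 1 then 1 else \<i>"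
  have "(\<Sum>n=1..2. \<Sum>m=1..2. ?c n * cnj (?c m) * complex_of_real (f (?x n - ?x m))) \<in> \<real>\<^sub>\<ge>\<^sub>0"
    using assms[unfolded positive_definite_def, THEN spec, of 2, THEN spec, of ?x, THEN spec, of ?c] .
  then show ?thesis
    by (simp add: numeral_2_eq_2 complex_nonneg_Reals_iff)
qed

section \<open>Haar measures\<close>

lemma haar_sets: "haar_measure M \<Longrightarrow> sets M = sets borel"
  by (simp add: haar_measure_def)

lemma haar_compact_finite: "haar_measure M \<Longrightarrow> compact K \<Longrightarrow> emeasure M K < \<infinity>"
  by (simp add: haar_measure_def)

lemma haar_measurable:
  "haar_measure M \<Longrightarrow> g \<in> borel_measurable borel \<Longrightarrow> g \<in> borel_measurable M"
  using measurable_cong_sets[OF haar_sets refl] by blast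

lemma haar_measurable_translate:
  assumes "haar_measure M"
  shows "(\<lambda>z. z - x) \<in> measurable M M"
proof -
  have "(\<lambda>z. z - x) \<in> measurable borel borel"
    by (intro borel_measurable_continuous_onI continuous_intros)
  then show ?thesis
    using measurable_cong_sets[OF haar_sets haar_sets, OF assms assms] by blast
qed

lemma haar_distr_translate:
  assumes "haar_measure M"
  shows "distr M M (\<lambda>z. z - x) = M"
proof (rule measure_eqI)
  have sp: "space M = UNIV"
    using sets_eq_imp_space_eq[OF haar_sets[OF assms]] by simp
  fix A assume "A \<in> sets (distr M M (\<lambda>z. z - x))"
  then have A: "A \<in> sets M"
    by simp
  have "(\<lambda>z. z - x) -` A \<inter> space M = (\<lambda>a. x + a) ` A"
  proof
    show "(\<lambda>z. z - x) -` A \<inter> space M \<subseteq> (\<lambda>a. x + a) ` A"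
      by (auto intro!: rev_image_eqI[where f = "\<lambda>a. x + a"])
  qed (auto simp: sp)
  then show "emeasure (distr M M (\<lambda>z. z - x)) A = emeasure M A"
    using emeasure_distr[OF haar_measurable_translate[OF assms] A] A assms
    unfolding haar_measure_def by metis
qed simp

lemma haar_integral_translate:
  fixes g :: "'a::{topological_ab_group_add, t2_space} \<Rightarrow> real"
  assumes "haar_measure M" "g \<in> borel_measurable borel"
  shows "(\<integral>z. g (z - x) \<partial>M) = (\<integral>z. g z \<partial>M)"
    and "integrable M (\<lambda>z. g (z - x)) \<longleftrightarrow> integrable M g"
  using integral_distr[OF haar_measurable_translate haar_measurable, OF assms(1) assms, of x]
    integrable_distr_eq[OF haar_measurable_translate haar_measurable, OF assms(1) assms, of x]
  by (simp_all add: haar_distr_translate[OF assms(1)])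

section \<open>The counting estimate for separated finite sets\<close>

text \<open>A continuous positive definite function of compact support, with the Haar measure against which
  it is integrated.\<close>

locale compactly_supported_positive_definite =
  fixes M :: "'a::{topological_ab_group_add, t2_space} measure" and f :: "'a \<Rightarrow> real"
  assumes haar: "haar_measure M"
    and cont: "continuous_on UNIV f"
    and pos_def: "positive_definite f"
    and compact_supp: "compact (supp f)"
begin

lemma measurable_f: "f \<in> borel_measurable borel"
  using cont by (rule borel_measurable_continuous_onI)

lemma f_diff_commute: "f (x - z) = f (z - x)"
  using positive_definite_even[OF pos_def, of "x - z"] by simp

lemma zero_outside_supp: "x \<notin> supp f \<Longrightarrow> f x = 0"
  using closure_subset[of "{x. f x \<noteq> 0}"] unfolding supp_def by blast

lemma integrable_f: "integrable M f"
proof -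
  have "bounded (f ` supp f)"
    by (intro compact_imp_bounded compact_continuous_image compact_supp
          continuous_on_subset[OF cont]) simp
  then obtain B where B: "\<And>x. x \<in> supp f \<Longrightarrow> norm (f x) \<le> B"
    by (auto simp: bounded_iff)
  show ?thesis
  proof (rule integrableI_bounded_set)
    show "supp f \<in> sets M"
      using haar_sets[OF haar] compact_supp by (simp add: borel_compact)
    show "emeasure M (supp f) < \<infinity>"
      by (rule haar_compact_finite[OF haar compact_supp])
  qed (use B zero_outside_supp haar_measurable[OF haar measurable_f] in auto)
qed

lemma integrable_reflected: "integrable M (\<lambda>z. f (x - z))"
  unfolding f_diff_commute[of x]
  using haar_integral_translate(2)[OF haar measurable_f] integrable_f by simp

lemma integral_reflected: "(\<integral>z. f (x - z) \<partial>M) = (\<integral>z. f z \<partial>M)"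
  unfolding f_diff_commute[of x]
  by (rule haar_integral_translate(1)[OF haar measurable_f])

lemma integral_abs_reflected: "(\<integral>z. \<bar>f (x - z)\<bar> \<partial>M) = (\<integral>z. \<bar>f z\<bar> \<partial>M)"
  unfolding f_diff_commute[of x]
  using haar_integral_translate(1)[OF haar, of "\<lambda>z. \<bar>f z\<bar>"] measurable_f by simp

lemma set_integrable_reflected:
  "W \<in> sets borel \<Longrightarrow> set_integrable M W (\<lambda>z. f (x - z))"
  unfolding set_integrable_def
  using integrable_mult_indicator[OF _ integrable_reflected] haar_sets[OF haar] by simp

lemma set_integral_reflected_eq:
  assumes "\<And>z. z - x \<in> supp f \<Longrightarrow> z \<in> W"
  shows "(LINT z:W|M. f (x - z)) = (\<integral>z. f z \<partial>M)"
proof -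
  have "(LINT z:W|M. f (x - z)) = (\<integral>z. f (x - z) \<partial>M)"
    unfolding set_lebesgue_integral_def
  proof (rule Bochner_Integration.integral_cong)
    show "indicator W z *\<^sub>R f (x - z) = f (x - z)" for z
      using assms[of z] zero_outside_supp[of "z - x"] f_diff_commute[of x z]
      by (auto simp: indicator_def)
  qed simp
  then show ?thesis
    by (simp add: integral_reflected)
qed

lemma set_integral_reflected_le:
  assumes "W \<in> sets borel"
  shows "(LINT z:W|M. f (x - z)) \<le> (\<integral>z. \<bar>f z\<bar> \<partial>M)"
proof -
  have "(LINT z:W|M. f (x - z)) \<le> (\<integral>z. \<bar>f (x - z)\<bar> \<partial>M)"
    using set_integrable_reflected[OF assms] integrable_reflected
    unfolding set_lebesgue_integral_def set_integrable_def
    by (intro integral_mono integrable_abs) (auto simp: indicator_def)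
  then show ?thesis
    by (simp add: integral_abs_reflected)
qed

lemma riemann_sum_error:
  assumes "compact W" "finite Y" "disjoint_family_on P Y"
    and "\<And>y. y \<in> Y \<Longrightarrow> P y \<in> sets borel" "\<Union>(P ` Y) = W"
    and "\<And>y z. y \<in> Y \<Longrightarrow> z \<in> P y \<Longrightarrow> \<bar>f (x - z) - f (x - y)\<bar> \<le> \<delta>"
  shows "\<bar>(\<Sum>y\<in>Y. measure M (P y) * f (x - y)) - (LINT z:W|M. f (x - z))\<bar> \<le> \<delta> * measure M W"
proof -
  have sets: "P y \<in> sets M" if "y \<in> Y" for y
    using assms(4)[OF that] haar_sets[OF haar] by simp
  have fin: "emeasure M (P y) < \<infinity>" if "y \<in> Y" for y
  proof -
    have "emeasure M (P y) \<le> emeasure M W"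
      using that assms(1,5) haar_sets[OF haar] by (intro emeasure_mono) (auto intro: borel_compact)
    then show ?thesis
      using haar_compact_finite[OF haar \<open>compact W\<close>] by (rule le_less_trans)
  qed
  have "(LINT z:W|M. f (x - z)) = (\<Sum>y\<in>Y. LINT z:P y|M. f (x - z))"
    unfolding assms(5)[symmetric]
    by (rule set_integral_finite_Union[OF assms(2,3)])
       (use assms(4) sets set_integrable_reflected in auto)
  moreover have "\<bar>measure M (P y) * f (x - y) - (LINT z:P y|M. f (x - z))\<bar> \<le> \<delta> * measure M (P y)"
    if y: "y \<in> Y" for y
  proof -
    have ind: "integrable M (\<lambda>z. indicator (P y) z * c)" for c :: real
      using sets[OF y] fin[OF y] by (simp add: integrable_mult_left)
    have int: "integrable M (\<lambda>z. indicator (P y) z * f (x - z))"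
      using set_integrable_reflected[OF assms(4)[OF y], of x] by (simp add: set_integrable_def)
    have "measure M (P y) * f (x - y) - (LINT z:P y|M. f (x - z))
        = (\<integral>z. indicator (P y) z * f (x - y) - indicator (P y) z * f (x - z) \<partial>M)"
      using ind int sets[OF y] by (simp add: set_lebesgue_integral_def)
    also have "norm \<dots> \<le> (\<integral>z. indicator (P y) z * \<delta> \<partial>M)"
    proof (rule order_trans[OF integral_norm_bound integral_mono])
      show "norm (indicator (P y) z * f (x - y) - indicator (P y) z * f (x - z)) \<le> indicator (P y) z * \<delta>"
        for z
        using assms(6)[OF y, of z] by (auto simp: indicator_def abs_minus_commute)
    qed (intro integrable_norm Bochner_Integration.integrable_diff ind int)+
    also have "\<dots> = \<delta> * measure M (P y)"
      using sets[OF y] by simp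
    finally show ?thesis
      by simp
  qed
  moreover have "measure M W = (\<Sum>y\<in>Y. measure M (P y))"
    unfolding assms(5)[symmetric]
  proof (rule measure_finite_Union[OF assms(2) _ assms(3)])
    show "emeasure M (P y) \<noteq> \<infinity>" if "y \<in> Y" for y
      using fin[OF that] by simp
  qed (use sets in auto)
  ultimately show ?thesis
    by (simp add: sum_subtractf[symmetric] sum_distrib_left order_trans[OF sum_abs sum_mono])
qed

text \<open>Positive definiteness applied to the signed measure \<open>\<delta>\<^sub>F - 1\<^sub>W M / \<integral>f\<close>. Since \<open>x + supp f \<subseteq> W\<close>
  for \<open>x \<in> F\<close>, each of the two cross terms is \<open>- card F\<close>, while the pairs of points of \<open>F\<close> contribute at
  most \<open>card F\<close>. In the quadratic term of \<open>1\<^sub>W\<close> the inner integral \<open>\<integral>\<^sub>W f (x - z) dz\<close> is \<open>\<integral>f\<close> for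
  \<open>x \<in> W'\<close> and at most \<open>\<integral>\<bar>f\<bar>\<close> for \<open>x \<in> W - W'\<close>.\<close>

lemma card_separated_le:
  fixes F W W' :: "'a set" and I J :: real
  defines "I \<equiv> \<integral>x. f x \<partial>M" and "J \<equiv> \<integral>x. \<bar>f x\<bar> \<partial>M"
  assumes F: "finite F" "F \<subseteq> W'" "\<And>x y. x \<in> F \<Longrightarrow> y \<in> F \<Longrightarrow> x \<noteq> y \<Longrightarrow> f (x - y) \<le> 0"
    and W: "compact W'" "compact W" "W' \<subseteq> W"
      "\<And>x z. x \<in> W' \<Longrightarrow> z - x \<in> supp f \<Longrightarrow> z \<in> W"
    and "f 0 = 1" "I > 0"
  shows "real (card F) * I\<^sup>2 \<le> I * measure M W + J * (measure M W - measure M W')"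
proof -
  define m m' N where "m = measure M W" and "m' = measure M W'" and "N = real (card F)"
  have meas: "W \<in> sets borel" "W' \<in> sets borel"
    using W by (auto intro: borel_compact)
  have m0: "m \<ge> 0" and N0: "N \<ge> 0" and J0: "J \<ge> 0"
    by (auto simp: m_def N_def J_def)
  \<comment> \<open>Riemann sums with oscillation at most \<open>\<delta>\<close> give the claim up to an error that is linear in \<open>\<delta>\<close>.\<close>
  have approx: "N * I\<^sup>2 \<le> I * m + J * (m - m') + \<delta> * (2 * I * N * m + 2 * m\<^sup>2)"
    if "\<delta> > 0" for \<delta>
  proof -
    obtain Y P where Y: "finite Y" "Y \<subseteq> W" and P: "disjoint_family_on P Y"
      "\<And>y. y \<in> Y \<Longrightarrow> P y \<in> sets borel" "\<Union>(P ` Y) = W"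
      and close: "\<And>x y z. x \<in> W \<Longrightarrow> y \<in> Y \<Longrightarrow> z \<in> P y \<Longrightarrow> \<bar>f (x - z) - f (x - y)\<bar> \<le> \<delta>"
      by (rule fine_borel_partition[OF cont \<open>compact W\<close> \<open>\<delta> > 0\<close>]) (rule that)
    define w where "w y = measure M (P y)" for y
    define R where "R x = (\<Sum>y\<in>Y. w y * f (x - y))" for x
    define h where "h x = (LINT z:W|M. f (x - z))" for x
    have w0: "w y \<ge> 0" for y
      by (simp add: w_def)
    have finW: "emeasure M A \<noteq> \<infinity>" if "A \<subseteq> W" "A \<in> sets borel" for A
      using emeasure_mono[OF that(1), of M] haar_sets[OF haar] meas haar_compact_finite[OF haar W(2)]
      by (auto simp: top_unique)
    have R: "\<bar>R x - h x\<bar> \<le> \<delta> * m" if "x \<in> W" for x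
      unfolding R_def h_def w_def m_def using riemann_sum_error[OF W(2) Y(1) P close[OF that]] by simp
    have h_in: "h x = I" if "x \<in> W'" for x
      unfolding h_def I_def using W(4)[OF that] by (rule set_integral_reflected_eq)
    have h_le: "h x \<le> J" for x
      unfolding h_def J_def by (rule set_integral_reflected_le[OF meas(1)])
    have sum_w: "(\<Sum>y\<in>Y. w y) = m"
      unfolding w_def m_def P(3)[symmetric]
    proof (rule measure_finite_Union[symmetric])
      show "emeasure M (P y) \<noteq> \<infinity>" if "y \<in> Y" for y
        using that P by (intro finW) auto
    qed (use Y P haar_sets[OF haar] in auto)
    have sum_w': "(\<Sum>y\<in>Y. measure M (P y - W')) = m - m'"
    proof -
      have "(\<Sum>y\<in>Y. measure M (P y - W')) = measure M (\<Union>y\<in>Y. P y - W')"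
      proof (rule measure_finite_Union[symmetric])
        show "emeasure M (P y - W') \<noteq> \<infinity>" if "y \<in> Y" for y
          using that P meas by (intro finW) auto
      qed (use Y P haar_sets[OF haar] meas in \<open>auto simp: disjoint_family_on_def\<close>)
      also have "(\<Union>y\<in>Y. P y - W') = W - W'"
        using P(3) by auto
      also have "measure M (W - W') = m - m'"
        unfolding m_def m'_def
        by (rule measure_Diff) (use meas haar_sets[OF haar] finW W(3) in auto)
      finally show ?thesis .
    qed
    \<comment> \<open>The sample point \<open>y\<close> may lie outside \<open>W'\<close> or even outside \<open>P y\<close>, so \<open>h y\<close> is compared with \<open>h\<close>
      at a point of \<open>P y \<inter> W'\<close>, if there is one.\<close>
    have hy: "w y * h y \<le> (I + \<delta> * m) * w y + J * measure M (P y - W')" if y: "y \<in> Y" for y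
    proof (cases "P y \<inter> W' = {}")
      case True
      have "w y * h y \<le> w y * J"
        using h_le w0 by (intro mult_left_mono)
      moreover have "P y - W' = P y"
        using True by auto
      moreover have "0 \<le> (I + \<delta> * m) * w y"
        using w0 m0 \<open>\<delta> > 0\<close> \<open>I > 0\<close> by simp
      ultimately show ?thesis
        by (simp add: w_def mult.commute)
    next
      case False
      then obtain z where z: "z \<in> P y" "z \<in> W'"
        by auto
      \<comment> \<open>As \<open>f\<close> is even, the fineness of the partition also controls \<open>f (y - t) - f (z - t)\<close>.\<close>
      have "h y - h z = (LINT t:W|M. f (y - t) - f (z - t))"
        unfolding h_def
        by (rule set_integral_diff(2)[symmetric]) (auto intro: set_integrable_reflected meas)
      also have "\<dots> \<le> (LINT t:W|M. \<delta>)"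
      proof (rule set_integral_mono)
        show "set_integrable M W (\<lambda>t. f (y - t) - f (z - t))"
          by (intro set_integral_diff(1) set_integrable_reflected meas)
        show "set_integrable M W (\<lambda>t. \<delta>)"
          using meas haar_sets[OF haar] finW[of W]
          by (simp add: set_integrable_def less_top)
        show "f (y - t) - f (z - t) \<le> \<delta>" if "t \<in> W" for t
          using close[OF that y z(1)] f_diff_commute[of t] by (simp add: abs_le_iff)
      qed
      also have "\<dots> = \<delta> * m"
        using meas haar_sets[OF haar] by (simp add: set_lebesgue_integral_def m_def)
      finally have "h y \<le> I + \<delta> * m"
        using h_in[OF z(2)] by simp
      then have "w y * h y \<le> (I + \<delta> * m) * w y"
        using mult_left_mono[OF _ w0[of y], of "h y" "I + \<delta> * m"] by (simp add: mult.commute)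
      then show ?thesis
        using J0 by (smt (verit) measure_nonneg mult_nonneg_nonneg)
    qed
    have quad: "(\<Sum>y\<in>Y. w y * R y) \<le> (I + 2 * \<delta> * m) * m + J * (m - m')"
    proof -
      have "(\<Sum>y\<in>Y. w y * R y)
          \<le> (\<Sum>y\<in>Y. (I + 2 * \<delta> * m) * w y + J * measure M (P y - W'))"
      proof (rule sum_mono)
        fix y assume y: "y \<in> Y"
        have "R y \<le> h y + \<delta> * m"
          using R[of y] y Y(2) by (auto simp: abs_le_iff)
        then have "w y * R y \<le> w y * (h y + \<delta> * m)"
          using w0 by (intro mult_left_mono)
        then show "w y * R y \<le> (I + 2 * \<delta> * m) * w y + J * measure M (P y - W')"
          using hy[OF y] by (simp add: algebra_simps)
      qed
      also have "\<dots> = (I + 2 * \<delta> * m) * m + J * (m - m')"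
        by (simp add: sum.distrib sum_distrib_left[symmetric] sum_w sum_w')
      finally show ?thesis .
    qed
    have cross: "(\<Sum>x\<in>F. R x) \<ge> N * (I - \<delta> * m)"
    proof -
      have "(\<Sum>x\<in>F. I - \<delta> * m) \<le> (\<Sum>x\<in>F. R x)"
      proof (rule sum_mono)
        fix x assume "x \<in> F"
        then have "x \<in> W'" "x \<in> W"
          using F W by auto
        then show "I - \<delta> * m \<le> R x"
          using R[of x] h_in[of x] by (auto simp: abs_le_iff)
      qed
      then show ?thesis
        by (simp add: N_def)
    qed
    \<comment> \<open>Only the terms \<open>x = y\<close>, each equal to \<open>f 0 = 1\<close>, can be positive.\<close>
    have diag: "(\<Sum>x\<in>F. \<Sum>y\<in>F. f (x - y)) \<le> N"
    proof -
      have "(\<Sum>y\<in>F. f (x - y)) \<le> (\<Sum>y\<in>F. if y = x then 1 else 0)" if "x \<in> F" for x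
        using F(3) that \<open>f 0 = 1\<close> by (intro sum_mono) auto
      then have "(\<Sum>x\<in>F. \<Sum>y\<in>F. f (x - y)) \<le> (\<Sum>x\<in>F. \<Sum>y\<in>F. if y = x then 1 else 0)"
        by (rule sum_mono)
      then show ?thesis
        using F(1) by (simp add: N_def)
    qed
    define t where "t = 1 / I"
    have tI: "t * I = 1" "t > 0"
      using \<open>I > 0\<close> by (auto simp: t_def)
    \<comment> \<open>Points of \<open>F\<close> get weight \<open>1\<close>, sample points \<open>y \<in> Y\<close> get weight \<open>- w y / I\<close>.\<close>
    let ?c = "case_sum (\<lambda>_. 1) (\<lambda>y. - t * w y)" and ?p = "case_sum (\<lambda>x. x) (\<lambda>y. y)"
    have "0 \<le> (\<Sum>i\<in>F <+> Y. \<Sum>j\<in>F <+> Y. ?c i * ?c j * f (?p i - ?p j))"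
      by (rule positive_definite_weighted_sum[OF pos_def]) (use F(1) Y(1) in simp)
    also have "\<dots> = (\<Sum>x\<in>F. \<Sum>y\<in>F. f (x - y)) + (\<Sum>x\<in>F. \<Sum>y\<in>Y. - t * w y * f (x - y))
        + ((\<Sum>y\<in>Y. \<Sum>x\<in>F. - t * w y * f (y - x)) + (\<Sum>y\<in>Y. \<Sum>z\<in>Y. (- t * w y) * (- t * w z) * f (y - z)))"
      using F(1) Y(1) by (simp only: sum.Plus sum.distrib o_def sum.case finite_Plus mult_1 mult_1_right)
    also have "(\<Sum>y\<in>Y. \<Sum>x\<in>F. - t * w y * f (y - x)) = (\<Sum>x\<in>F. \<Sum>y\<in>Y. - t * w y * f (x - y))"
      by (subst sum.swap) (simp only: f_diff_commute)
    also have "(\<Sum>x\<in>F. \<Sum>y\<in>Y. - t * w y * f (x - y)) = - t * (\<Sum>x\<in>F. R x)"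
      by (simp add: R_def sum_distrib_left sum_negf mult.assoc)
    also have "(\<Sum>y\<in>Y. \<Sum>z\<in>Y. (- t * w y) * (- t * w z) * f (y - z)) = t\<^sup>2 * (\<Sum>y\<in>Y. w y * R y)"
      by (simp add: R_def sum_distrib_left power2_eq_square mult.assoc mult.left_commute)
    finally have "0 \<le> N - 2 * (t * (N * (I - \<delta> * m))) + t\<^sup>2 * ((I + 2 * \<delta> * m) * m + J * (m - m'))"
      using diag mult_left_mono[OF cross less_imp_le[OF tI(2)]] mult_left_mono[OF quad zero_le_power2, of t]
      by linarith
    then have "0 \<le> I\<^sup>2 * (N - 2 * (t * (N * (I - \<delta> * m))) + t\<^sup>2 * ((I + 2 * \<delta> * m) * m + J * (m - m')))"
      by simp
    also have "\<dots> = I\<^sup>2 * N - 2 * I * (t * I) * (N * (I - \<delta> * m))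
        + (t * I)\<^sup>2 * ((I + 2 * \<delta> * m) * m + J * (m - m'))"
      by (simp add: algebra_simps power2_eq_square)
    finally show ?thesis
      unfolding tI by (simp add: algebra_simps power2_eq_square)
  qed
  show ?thesis
  proof (rule ccontr)
    define X K where "X = N * I\<^sup>2 - (I * m + J * (m - m'))" and "K = 2 * I * N * m + 2 * m\<^sup>2"
    assume "\<not> ?thesis"
    then have "X > 0"
      by (simp add: X_def N_def m_def m'_def)
    moreover have "K \<ge> 0"
      using N0 m0 \<open>I > 0\<close> by (simp add: K_def)
    ultimately have "X \<le> X / (K + 1) * K"
      using approx[of "X / (K + 1)"] by (simp add: X_def K_def)
    then show False
      using \<open>X > 0\<close> \<open>K \<ge> 0\<close> by (simp add: field_simps)
  qed
qed

end

section \<open>The density bound\<close>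

lemma finite_subset_card_gt:
  assumes "x < emeasure (count_space UNIV) A"
  obtains F where "finite F" "F \<subseteq> A" "x < of_nat (card F)"
proof (cases "finite A")
  case True
  then show ?thesis
    using assms that[of A] by simp
next
  case False
  then have "x < top"
    using assms by (simp add: less_top)
  then obtain n where "x < of_nat n"
    using ennreal_Ex_less_of_nat by blast
  moreover obtain F where "finite F" "card F = n" "F \<subseteq> A"
    using infinite_arbitrarily_large[OF False] by blast
  ultimately show ?thesis
    using that by blast
qed

context compactly_supported_positive_definite
begin

text \<open>For every \<open>a > 1 / \<integral>f\<close> one compact \<open>C\<close>, independent of \<open>F\<close>, works for all finite
  \<open>F \<subseteq> \<Lambda>\<close>. If \<open>F\<close> violated the bound for \<open>C = (n + 1) S\<close> with \<open>S = supp f\<close>, then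
  \<open>card_separated_le\<close> for each pair \<open>k S + F \<subseteq> (k + 1) S + F\<close> would force these measures to grow
  geometrically in \<open>k\<close>, which is impossible: the first one is already at least a constant times
  \<open>card F\<close> and the last one is less than \<open>card F / a\<close>.\<close>

lemma card_separated_le_measure_sum_set:
  fixes \<Lambda> :: "'a set" and I J :: real
  defines "I \<equiv> \<integral>x. f x \<partial>M" and "J \<equiv> \<integral>x. \<bar>f x\<bar> \<partial>M"
  assumes "f 0 = 1" "I > 0" "a * I > 1"
    and sep: "\<And>x y. x \<in> \<Lambda> \<Longrightarrow> y \<in> \<Lambda> \<Longrightarrow> x \<noteq> y \<Longrightarrow> f (x - y) \<le> 0"
  obtains C where "compact C"
    "\<And>F. finite F \<Longrightarrow> F \<subseteq> \<Lambda> \<Longrightarrow> real (card F) \<le> a * measure M (sum_set C F)"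
proof -
  define c where "c = (a * I\<^sup>2 - I) / J"
  have "I \<le> J"
    unfolding I_def J_def using integrable_f by (intro integral_mono) auto
  with \<open>I > 0\<close> have "J > 0"
    by simp
  have "a > 0"
    using \<open>a * I > 1\<close> \<open>I > 0\<close> by (metis less_trans zero_less_one zero_less_mult_pos2)
  have "a * I\<^sup>2 - I > 0"
    using mult_strict_right_mono[OF \<open>a * I > 1\<close> \<open>I > 0\<close>] by (simp add: power2_eq_square mult.assoc)
  then have "c > 0"
    using \<open>J > 0\<close> by (simp add: c_def)
  then obtain n where n: "(I + J) / (a * I\<^sup>2) < (1 + c) ^ n"
    using real_arch_pow[of "1 + c"] by auto
  \<comment> \<open>The measures grow from \<open>1 S + F\<close> to \<open>(n + 1) S + F\<close>, that is, in \<open>n\<close> steps.\<close>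
  define C where "C = iterated_sum (supp f) (Suc n)"
  have zero_in: "0 \<in> supp f"
    using zero_outside_supp \<open>f 0 = 1\<close> by force
  show ?thesis
  proof (rule that[of C])
    show "compact C"
      unfolding C_def by (rule compact_iterated_sum[OF compact_supp])
    fix F assume F: "finite F" "F \<subseteq> \<Lambda>"
    define N where "N = real (card F)"
    define W where "W k = sum_set (iterated_sum (supp f) k) F" for k
    define w where "w k = measure M (W k)" for k
    have W_Suc: "W (Suc k) = sum_set (supp f) (W k)" for k
      unfolding W_def by (rule sum_set_iterated_sum_Suc)
    have cpt: "compact (W k)" for k
      unfolding W_def
      by (intro compact_sum_set compact_iterated_sum compact_supp finite_imp_compact F)
    have W_step: "W k \<subseteq> W (Suc k)" for k
      unfolding W_Suc sum_set_def using zero_in by force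
    have W_mono: "W k \<subseteq> W l" if "k \<le> l" for k l
      using that W_step by (rule lift_Suc_mono_le[rotated])
    have F_sub: "F \<subseteq> W k" for k
      using W_mono[of 0 k] by (simp add: W_def sum_set_iterated_sum_0)
    have w0: "w k \<ge> 0" for k
      by (simp add: w_def)
    have w_mono: "w k \<le> w l" if "k \<le> l" for k l
      unfolding w_def
    proof (rule measure_mono_fmeasurable[OF W_mono[OF that]])
      show sets: "W k \<in> sets M" for k
        using cpt haar_sets[OF haar] by (simp add: borel_compact)
      show "W l \<in> fmeasurable M"
        by (rule fmeasurableI[OF sets haar_compact_finite[OF haar cpt]])
    qed
    have key: "N * I\<^sup>2 \<le> I * w (Suc k) + J * (w (Suc k) - w k)" for k
      unfolding N_def w_def I_def J_def
    proof (rule card_separated_le)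
      show "z \<in> W (Suc k)" if "x \<in> W k" "z - x \<in> supp f" for x z
      proof -
        have "z = (z - x) + x"
          by simp
        then show ?thesis
          unfolding W_Suc sum_set_def using that by blast
      qed
      show "f (x - y) \<le> 0" if "x \<in> F" "y \<in> F" "x \<noteq> y" for x y
        using that F sep by blast
    qed (use F F_sub cpt W_step \<open>f 0 = 1\<close> \<open>I > 0\<close> in \<open>auto simp: I_def\<close>)
    show "real (card F) \<le> a * measure M (sum_set C F)"
    proof (rule ccontr)
      assume "\<not> ?thesis"
      then have less: "a * w (Suc n) < N"
        by (simp add: N_def w_def W_def C_def)
      have growth: "(1 + c) * w k \<le> w (Suc k)" if "k \<le> n" for k
      proof -
        have "a * w (Suc k) \<le> a * w (Suc n)"
          using w_mono[of "Suc k" "Suc n"] that \<open>a > 0\<close> by simp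
        then have "a * w (Suc k) * I\<^sup>2 \<le> N * I\<^sup>2"
          using less by (intro mult_right_mono) auto
        also note key[of k]
        finally have "(a * I\<^sup>2 - I) * w (Suc k) + J * w k \<le> J * w (Suc k)"
          by (simp add: algebra_simps)
        moreover have "(a * I\<^sup>2 - I) * w k \<le> (a * I\<^sup>2 - I) * w (Suc k)"
          using w_mono[of k "Suc k"] \<open>a * I\<^sup>2 - I > 0\<close> by (intro mult_left_mono) auto
        ultimately have "(a * I\<^sup>2 - I) * w k + J * w k \<le> J * w (Suc k)"
          by linarith
        then show ?thesis
          using \<open>J > 0\<close> by (simp add: c_def field_simps)
      qed
      have power: "(1 + c) ^ k * w 1 \<le> w (Suc k)" if "k \<le> n" for k
        using that
      proof (induction k)
        case (Suc k)
        then have "(1 + c) * ((1 + c) ^ k * w 1) \<le> (1 + c) * w (Suc k)"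
          using \<open>c > 0\<close> by (intro mult_left_mono) auto
        also have "\<dots> \<le> w (Suc (Suc k))"
          using growth Suc.prems by blast
        finally show ?case
          by (simp add: mult.assoc)
      qed simp
      have "N > 0"
        using less w0[of "Suc n"] \<open>a > 0\<close> by (meson le_less_trans mult_nonneg_nonneg less_imp_le)
      \<comment> \<open>The estimate for \<open>F \<subseteq> S + F\<close> bounds \<open>card F\<close> by the measure of \<open>S + F\<close>.\<close>
      have "N * I\<^sup>2 \<le> (I + J) * w 1"
        using key[of 0] w0[of 0] \<open>J > 0\<close> by (simp add: algebra_simps) (smt (verit) mult_nonneg_nonneg)
      then have "(1 + c) ^ n * (N * I\<^sup>2) \<le> (1 + c) ^ n * ((I + J) * w 1)"
        using \<open>c > 0\<close> by (intro mult_left_mono) auto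
      also have "\<dots> = (I + J) * ((1 + c) ^ n * w 1)"
        by simp
      also have "\<dots> \<le> (I + J) * w (Suc n)"
        using power[of n] \<open>I > 0\<close> \<open>J > 0\<close> by (intro mult_left_mono) auto
      finally have "a * ((1 + c) ^ n * (N * I\<^sup>2)) \<le> a * ((I + J) * w (Suc n))"
        using \<open>a > 0\<close> by simp
      also have "\<dots> = (I + J) * (a * w (Suc n))"
        by simp
      also have "\<dots> < (I + J) * N"
        using less \<open>I > 0\<close> \<open>J > 0\<close> by simp
      also have "\<dots> \<le> ((1 + c) ^ n * (a * I\<^sup>2)) * N"
        using n \<open>a > 0\<close> \<open>I > 0\<close> \<open>N > 0\<close> by (intro mult_right_mono) (auto simp: field_simps)
      finally show False
        by (simp add: mult_ac)
    qed
  qed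
qed

text \<open>Replacing \<open>\<Lambda> \<inter> V\<close> by a finite subset \<open>F\<close> makes \<open>C + F\<close> compact, hence Borel; the outer measure
  of \<open>C + V\<close> only enters through monotonicity.\<close>

lemma upper_density_le:
  fixes \<Lambda> :: "'a set" and I :: real
  defines "I \<equiv> \<integral>x. f x \<partial>M"
  assumes "f 0 = 1" "I > 0"
    and sep: "\<And>x y. x \<in> \<Lambda> \<Longrightarrow> y \<in> \<Lambda> \<Longrightarrow> x \<noteq> y \<Longrightarrow> f (x - y) \<le> 0"
  shows "upper_density M \<Lambda> \<le> ennreal (1 / I)"
proof (rule ennreal_le_epsilon)
  fix e :: real assume "e > 0"
  define a where "a = 1 / I + e"
  have "a * I > 1" "a > 0"
    using \<open>e > 0\<close> \<open>I > 0\<close> by (auto simp: a_def field_simps add_pos_pos)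
  obtain C where C: "compact C"
    and bound: "\<And>F. finite F \<Longrightarrow> F \<subseteq> \<Lambda> \<Longrightarrow> real (card F) \<le> a * measure M (sum_set C F)"
    using card_separated_le_measure_sum_set[OF \<open>f 0 = 1\<close>, of a \<Lambda>] \<open>I > 0\<close> \<open>a * I > 1\<close> sep
    unfolding I_def by blast
  have "emeasure (count_space UNIV) (\<Lambda> \<inter> V) / outer_measure_of M (sum_set C V) \<le> ennreal a" for V
  proof -
    let ?o = "outer_measure_of M (sum_set C V)" and ?n = "emeasure (count_space UNIV) (\<Lambda> \<inter> V)"
    have "?n \<le> ?o * ennreal a"
    proof (rule ccontr)
      assume "\<not> ?thesis"
      then obtain F where F: "finite F" "F \<subseteq> \<Lambda> \<inter> V" "?o * ennreal a < of_nat (card F)"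
        using finite_subset_card_gt[of "?o * ennreal a" "\<Lambda> \<inter> V"] by (auto simp: not_le)
      have cpt: "compact (sum_set C F)"
        by (intro compact_sum_set C finite_imp_compact F)
      have "ennreal (measure M (sum_set C F)) = outer_measure_of M (sum_set C F)"
        using cpt haar_sets[OF haar] haar_compact_finite[OF haar cpt]
        by (simp add: borel_compact emeasure_eq_ennreal_measure)
      also have "\<dots> \<le> ?o"
        using F(2) by (intro outer_measure_of_mono) (auto simp: sum_set_def)
      finally have "ennreal (measure M (sum_set C F)) * ennreal a \<le> ?o * ennreal a"
        by (intro mult_right_mono) auto
      also note F(3)
      finally have "ennreal (a * measure M (sum_set C F)) < ennreal (real (card F))"
        using \<open>a > 0\<close> by (simp add: ennreal_mult' mult.commute ennreal_of_nat_eq_real_of_nat)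
      then have "a * measure M (sum_set C F) < real (card F)"
        using \<open>a > 0\<close> by (subst (asm) ennreal_less_iff) auto
      then show False
        using bound[of F] F by auto
    qed
    then show ?thesis
      by (cases "?o = 0") (auto intro: divide_le_posI_ennreal simp: zero_less_iff_neq_zero)
  qed
  then have "upper_density M \<Lambda> \<le> ennreal a"
    unfolding upper_density_def
    by (intro INF_lower2[of C] SUP_least) (auto simp: compact_subset_def C)
  then show "upper_density M \<Lambda> \<le> ennreal (1 / I) + ennreal e"
    using \<open>e > 0\<close> \<open>I > 0\<close> by (simp add: a_def)
qed

end

lemma supp_eq_pos_neg: "supp f = supp (pos_part f) \<union> supp (neg_part f)"
proof -
  have "{x. f x \<noteq> 0} = {x. pos_part f x \<noteq> 0} \<union> {x. neg_part f x \<noteq> 0}"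
    by (auto simp: pos_part_def neg_part_def max_def)
  then show ?thesis
    by (simp add: supp_def closure_Un)
qed

theorem corollary1p1:
  fixes M :: "'a::{topological_ab_group_add, t2_space} measure"
    and \<Omega>p \<Omega>m \<Lambda> :: "'a set"
  assumes "locally compact (UNIV :: 'a set)"
    and "haar_measure M"
    and "open \<Omega>p" and "zero_symmetric \<Omega>p" and "0 \<in> \<Omega>p"
    and "\<Omega>p \<inter> difference_set \<Lambda> = {0}"
    and "open \<Omega>m" and "zero_symmetric \<Omega>m"
  shows "extremal_const M \<Omega>p \<Omega>m \<le> enn2ereal (1 / upper_density M \<Lambda>)"
proof -
  have "ereal (\<integral>x. f x \<partial>M) \<le> enn2ereal (1 / upper_density M \<Lambda>)" if "f \<in> admissible \<Omega>p \<Omega>m" for f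
  proof (cases "(\<integral>x. f x \<partial>M) > 0")
    case True
    define I where "I = (\<integral>x. f x \<partial>M)"
    interpret compactly_supported_positive_definite M f
      by standard (use that assms(2) in \<open>auto simp: admissible_def compact_subset_def supp_eq_pos_neg[of f]\<close>)
    have "f (x - y) \<le> 0" if "x \<in> \<Lambda>" "y \<in> \<Lambda>" "x \<noteq> y" for x y
    proof (rule ccontr)
      assume "\<not> ?thesis"
      then have "x - y \<in> supp (pos_part f)"
        unfolding supp_def by (intro subsetD[OF closure_subset]) (simp add: pos_part_def)
      then have "x - y \<in> \<Omega>p"
        using \<open>f \<in> admissible \<Omega>p \<Omega>m\<close> by (auto simp: admissible_def compact_subset_def)
      then have "x - y \<in> {0}"
        using that assms(6) unfolding difference_set_def by blast
      then show False
        using that by simp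
    qed
    then have le: "upper_density M \<Lambda> \<le> ennreal (1 / I)"
      unfolding I_def
      using True that by (intro upper_density_le) (auto simp: admissible_def)
    have "ennreal I \<le> 1 / upper_density M \<Lambda>"
    proof (cases "upper_density M \<Lambda>")
      case (real r)
      show ?thesis
      proof (cases "r = 0")
        case False
        then have "r > 0" "r \<le> 1 / I"
          using real le True by (auto simp: I_def)
        then have "I \<le> 1 / r"
          using True by (simp add: I_def field_simps)
        then have "ennreal I \<le> ennreal (1 / r)"
          by (rule ennreal_leI)
        then show ?thesis
          using \<open>r > 0\<close> real by (simp add: divide_ennreal[symmetric])
      qed (use real in simp)
    qed (use le in \<open>simp add: top_unique\<close>)
    then have "enn2ereal (ennreal I) \<le> enn2ereal (1 / upper_density M \<Lambda>)"
      by (simp only: less_eq_ennreal.rep_eq)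
    then show ?thesis
      using True by (simp add: I_def enn2ereal_ennreal)
  next
    case False
    then have "ereal (\<integral>x. f x \<partial>M) \<le> 0"
      by simp
    also have "\<dots> \<le> enn2ereal (1 / upper_density M \<Lambda>)"
      by simp
    finally show ?thesis .
  qed
  then show ?thesis
    unfolding extremal_const_def by (auto intro: SUP_least)
qed

end
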